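(* Let $U$ be a random variable uniformly distributed on $[0,1]$, and let $E_1,E_2$ be independent random variables, each with the exponential density $e^{-x}$, $x\in[0,+\infty)$. Then for all integers $n\ge 0$ and all $x\in\mathbb{R}$, the Bernoulli polynomials satisfy $$B_n(x)=E\left(\frac{\imath}{2\pi}\log\frac{U}{1-U}+x-\frac12\right)^n=E\left(\frac{\imath}{2\pi}\log\frac{E_1}{E_2}+x-\frac12\right)^n,$$ and the Bernoulli numbers satisfy $$B_n=E\left(\frac{\imath}{2\pi}\log\frac{U}{1-U}-\frac12\right)^n=E\left(\frac{\imath}{2\pi}\log\frac{E_1}{E_2}-\frac12\right)^n,\quad n\ge 0.$$
   Context: $E$ (without index) denotes expectation, applied to the whole $n$-th power, and $\imath^2=-1$. The Bernoulli polynomials $B_n(x)$ are defined by $\sum_{n\ge0}B_n(x)\frac{t^n}{n!}=\frac{te^{tx}}{e^t-1}$, $|t|<2\pi$, $x\in\mathbb{R}$, and the Bernoulli numbers are $B_n=B_n(0)$ (so $B_1=-\frac12$). *)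

theory Defs
  imports "HOL-Probability.Probability" "HOL-Complex_Analysis.Complex_Analysis"
begin

text \<open>
  The singularity of the generating function at \<open>t = 0\<close> is removable; the limit there is 1, whereas
  the HOL quotient would be 0.
\<close>

definition bernoulli_gf :: "real \<Rightarrow> real \<Rightarrow> real" where
  "bernoulli_gf x t = (if t = 0 then 1 else t * exp (t * x) / (exp t - 1))"

definition bernoulli_poly :: "nat \<Rightarrow> real \<Rightarrow> real" where
  "bernoulli_poly n x =
     (THE B :: nat \<Rightarrow> real. \<forall>t. \<bar>t\<bar> < 2 * pi \<longrightarrow> (\<lambda>k. B k * t ^ k / fact k) sums bernoulli_gf x t) n"

definition bernoulli_num :: "nat \<Rightarrow> real" where
  "bernoulli_num n = bernoulli_poly n 0"

text \<open>The description above is proper: exactly one coefficient sequence satisfies it.\<close>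

lemma bernoulli_gf_expansion_exists:
  "\<exists>B :: nat \<Rightarrow> real. \<forall>t. \<bar>t\<bar> < 2 * pi \<longrightarrow> (\<lambda>k. B k * t ^ k / fact k) sums bernoulli_gf x t"
proof -
  define g :: "complex \<Rightarrow> complex"
    where "g = (\<lambda>z. if z = 0 then deriv exp 0 else (exp z - exp 0) / (z - 0))"
  define f where "f = (\<lambda>z. exp (z * of_real x) / g z)"
  have g_holo: "g holomorphic_on ball 0 (2 * pi)"
    unfolding g_def by (rule pole_lemma_open) (auto intro!: holomorphic_intros)
  have g0: "g 0 = 1"
    by (simp add: g_def DERIV_imp_deriv[OF DERIV_exp])
  have g_nz: "g z \<noteq> 0" if "z \<in> ball 0 (2 * pi)" for z
  proof (cases "z = 0")
    case False
    have "exp z \<noteq> 1"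
    proof
      assume "exp z = 1"
      then obtain m :: int where m: "Re z = 0" "Im z = of_int (2 * m) * pi"
        by (auto simp: exp_eq_1)
      have "\<bar>Im z\<bar> < 2 * pi"
        using that abs_Im_le_cmod[of z] by simp
      hence "\<bar>real_of_int m\<bar> < 1"
        using m by (simp add: abs_mult)
      hence "m = 0"
        by linarith
      thus False
        using m False by (simp add: complex_eq_iff)
    qed
    thus ?thesis
      using False by (simp add: g_def)
  qed (simp add: g0)
  have f_holo: "f holomorphic_on ball 0 (2 * pi)"
    unfolding f_def using g_nz by (intro holomorphic_intros g_holo) auto
  have f_real: "f (of_real t) = of_real (bernoulli_gf x t)" for t
  proof (cases "t = 0")
    case False
    have "f (of_real t) = of_real t * exp (of_real (t * x)) / (exp (of_real t) - 1)"
      using False by (simp add: f_def g_def)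
    also have "\<dots> = of_real (bernoulli_gf x t)"
      using False unfolding bernoulli_gf_def exp_of_real by simp
    finally show ?thesis .
  qed (simp add: f_def g0 bernoulli_gf_def)
  have "(\<lambda>k. Re ((deriv ^^ k) f 0) * t ^ k / fact k) sums bernoulli_gf x t"
    if "\<bar>t\<bar> < 2 * pi" for t
  proof -
    have "(\<lambda>k. (deriv ^^ k) f 0 / fact k * (of_real t - 0) ^ k) sums f (of_real t)"
      by (rule holomorphic_power_series[OF f_holo]) (use that in simp)
    hence "(\<lambda>k. Re ((deriv ^^ k) f 0 / fact k * (of_real t - 0) ^ k)) sums Re (f (of_real t))"
      by (rule sums_Re)
    moreover have "Re ((deriv ^^ k) f 0 / fact k * (of_real t - 0) ^ k) =
                     Re ((deriv ^^ k) f 0) * t ^ k / fact k" for k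
    proof -
      have "(deriv ^^ k) f 0 / fact k * (of_real t - 0) ^ k =
              (deriv ^^ k) f 0 * of_real (t ^ k / fact k)"
        by simp
      thus ?thesis
        by (simp only: Re_complex_of_real Im_complex_of_real times_complex.sel mult_zero_right diff_zero times_divide_eq_right)
    qed
    ultimately show ?thesis
      by (simp add: f_real)
  qed
  thus ?thesis
    by (intro exI[of _ "\<lambda>k. Re ((deriv ^^ k) f 0)"]) blast
qed

lemma bernoulli_gf_expansion_unique:
  fixes A B :: "nat \<Rightarrow> real"
  assumes A: "\<And>t. \<bar>t\<bar> < 2 * pi \<Longrightarrow> (\<lambda>k. A k * t ^ k / fact k) sums bernoulli_gf x t"
    and B: "\<And>t. \<bar>t\<bar> < 2 * pi \<Longrightarrow> (\<lambda>k. B k * t ^ k / fact k) sums bernoulli_gf x t"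
  shows "A = B"
proof (rule ccontr)
  define c where "c = (\<lambda>k. (A k - B k) / fact k)"
  assume "A \<noteq> B"
  then obtain m where m: "c m \<noteq> 0"
    by (auto simp: c_def fun_eq_iff)
  have sm: "(\<lambda>k. c k * (t - 0) ^ k) sums 0" if "norm (t - 0) < 2 * pi" for t
    using sums_diff[OF A[of t] B[of t]] that
    by (simp add: c_def diff_divide_distrib algebra_simps)
  have "c 0 = 0"
    using sm[of 0] by simp
  with m have "m > 0"
    by (cases m) auto
  obtain s where s: "0 < s" and nz: "\<And>z :: real. z \<in> cball 0 s - {0} \<Longrightarrow> (0 :: real) \<noteq> 0"
    by (rule powser_0_nonzero[of "2 * pi" 0 c "\<lambda>_. 0" m]) (use sm m \<open>m > 0\<close> in auto)
  show False
    using nz[of s] s by simp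
qed

lemma bernoulli_poly_sums:
  assumes "\<bar>t\<bar> < 2 * pi"
  shows "(\<lambda>k. bernoulli_poly k x * t ^ k / fact k) sums bernoulli_gf x t"
proof -
  let ?P = "\<lambda>B :: nat \<Rightarrow> real. \<forall>t. \<bar>t\<bar> < 2 * pi \<longrightarrow> (\<lambda>k. B k * t ^ k / fact k) sums bernoulli_gf x t"
  have "\<exists>!B. ?P B"
    using bernoulli_gf_expansion_exists[of x] bernoulli_gf_expansion_unique[of _ x]
    by (intro ex_ex1I) blast+
  hence "?P (THE B. ?P B)"
    by (rule theI')
  thus ?thesis
    using assms by (simp add: bernoulli_poly_def)
qed

end

theory Submission
  imports Defs
begin

text \<open>
  Write \<open>L\<close> for either of the two random variables \<open>ln (U / (1 - U))\<close> and \<open>ln (E1 / E2)\<close>. Both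
  have the standard logistic law, and the only information about that law which the proof uses is its
  moment generating function \<open>E exp (a L) = \<Gamma>(1 + a) \<Gamma>(1 - a)\<close> for real \<open>\<bar>a\<bar> < 1\<close>: for \<open>U\<close> this is
  Euler's Beta integral (\<open>uniform_logit_mgf\<close>), for \<open>E1 / E2\<close> it is a product of two Gamma integrals
  (\<open>exponential_ratio_mgf\<close>).

  Since \<open>exp (r \<bar>L\<bar>)\<close> is integrable for \<open>r < 1\<close>, the exponential series can be integrated term by
  term (\<open>integral_exp_power_series\<close>). Hence \<open>z \<mapsto> E exp (z L)\<close> is holomorphic on the open unit disc,
  and analytic continuation carries the formula \<open>\<Gamma>(1 + z) \<Gamma>(1 - z) = \<pi> z / sin (\<pi> z)\<close> from the real
  diameter to the whole disc (\<open>logistic_mgf_complex\<close>). At \<open>z = \<i> t / (2 \<pi>)\<close> it reads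
  \<open>E exp (\<i> t L / (2 \<pi>)) = (t / 2) / sinh (t / 2)\<close>, and multiplying by \<open>exp (t (x - 1 / 2))\<close> yields
  the generating function \<open>t exp (t x) / (exp t - 1)\<close> of the Bernoulli polynomials for
  \<open>\<bar>t\<bar> < 2 \<pi>\<close>. Term-by-term integration of \<open>exp (t (\<i> L / (2 \<pi>) + x - 1 / 2))\<close> expands the same
  function with the moments of \<open>\<i> L / (2 \<pi>) + x - 1 / 2\<close> as coefficients, and the expansion is
  unique.
\<close>

section \<open>Exponential moments and power series of moments\<close>

lemma integrable_power_of_exp_norm:
  fixes W :: "'a \<Rightarrow> complex"
  assumes [measurable]: "W \<in> borel_measurable M"
    and r: "r > 0" and int: "integrable M (\<lambda>\<omega>. exp (r * norm (W \<omega>)))"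
  shows "integrable M (\<lambda>\<omega>. W \<omega> ^ k)"
proof (rule Bochner_Integration.integrable_bound)
  show "integrable M (\<lambda>\<omega>. (fact k / r ^ k) * exp (r * norm (W \<omega>)))"
    by (intro integrable_mult_right int)
  show "AE \<omega> in M. norm (W \<omega> ^ k) \<le> norm ((fact k / r ^ k) * exp (r * norm (W \<omega>)))"
  proof (rule AE_I2)
    fix \<omega>
    \<comment> \<open>A single term of the exponential series is at most the whole series.\<close>
    have "(\<Sum>j\<in>{k}. (r * norm (W \<omega>)) ^ j /\<^sub>R fact j) \<le> exp (r * norm (W \<omega>))"
      unfolding exp_def by (rule sum_le_suminf[OF summable_exp_generic]) (use r in auto)
    thus "norm (W \<omega> ^ k) \<le> norm ((fact k / r ^ k) * exp (r * norm (W \<omega>)))"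
      using r by (simp add: norm_power power_mult_distrib field_simps)
  qed
qed measurable

text \<open>
  The partial sums of the norms are dominated by \<open>exp (norm z * norm (W \<omega>))\<close>, so the exponential
  series may be integrated term by term.
\<close>

lemma integral_exp_power_series:
  fixes W :: "'a \<Rightarrow> complex" and z :: complex
  assumes [measurable]: "W \<in> borel_measurable M"
    and r: "r > 0" "norm z \<le> r" and int: "integrable M (\<lambda>\<omega>. exp (r * norm (W \<omega>)))"
  shows "(\<lambda>k. (\<integral>\<omega>. W \<omega> ^ k \<partial>M) * z ^ k / fact k) sums (\<integral>\<omega>. exp (z * W \<omega>) \<partial>M)"
proof -
  let ?f = "\<lambda>k \<omega>. (z * W \<omega>) ^ k /\<^sub>R fact k"
  have f_eq: "?f k \<omega> = (z ^ k / fact k) * W \<omega> ^ k" for k \<omega>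
    by (simp add: power_mult_distrib scaleR_conv_of_real field_simps)
  have f_int: "integrable M (?f k)" for k
    unfolding f_eq by (intro integrable_mult_right integrable_power_of_exp_norm[OF assms(1) r(1) int])
  have norm_f: "norm (?f k \<omega>) = (norm (z * W \<omega>)) ^ k /\<^sub>R fact k" for k \<omega>
    by (simp add: norm_power)
  have "(\<lambda>k. integral\<^sup>L M (?f k)) sums (\<integral>\<omega>. (\<Sum>k. ?f k \<omega>) \<partial>M)"
  proof (rule sums_integral)
    show "AE \<omega> in M. summable (\<lambda>k. norm (?f k \<omega>))"
      unfolding norm_f by (intro AE_I2 summable_exp_generic)
    show "summable (\<lambda>k. \<integral>\<omega>. norm (?f k \<omega>) \<partial>M)"
    proof (rule bounded_imp_summable)
      show "0 \<le> (\<integral>\<omega>. norm (?f k \<omega>) \<partial>M)" for k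
        by (intro integral_nonneg_AE AE_I2) auto
      show "(\<Sum>k\<le>n. \<integral>\<omega>. norm (?f k \<omega>) \<partial>M) \<le> (\<integral>\<omega>. exp (r * norm (W \<omega>)) \<partial>M)" for n
      proof -
        have "(\<Sum>k\<le>n. \<integral>\<omega>. norm (?f k \<omega>) \<partial>M) = (\<integral>\<omega>. (\<Sum>k\<le>n. norm (?f k \<omega>)) \<partial>M)"
          by (rule Bochner_Integration.integral_sum[symmetric]) (intro integrable_norm f_int)
        also have "\<dots> \<le> (\<integral>\<omega>. exp (r * norm (W \<omega>)) \<partial>M)"
        proof (rule integral_mono[OF _ int])
          show "integrable M (\<lambda>\<omega>. \<Sum>k\<le>n. norm (?f k \<omega>))"
            by (intro Bochner_Integration.integrable_sum integrable_norm f_int)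
          fix \<omega>
          have "(\<Sum>k\<le>n. norm (?f k \<omega>)) \<le> exp (norm (z * W \<omega>))"
            unfolding norm_f exp_def by (rule sum_le_suminf[OF summable_exp_generic]) auto
          also have "\<dots> \<le> exp (r * norm (W \<omega>))"
            using r by (simp add: norm_mult mult_right_mono)
          finally show "(\<Sum>k\<le>n. norm (?f k \<omega>)) \<le> exp (r * norm (W \<omega>))" .
        qed
        finally show ?thesis .
      qed
    qed
  qed (rule f_int)
  moreover have "integral\<^sup>L M (?f k) = (\<integral>\<omega>. W \<omega> ^ k \<partial>M) * z ^ k / fact k" for k
    unfolding f_eq by simp
  ultimately show ?thesis
    by (simp add: exp_def)
qed

section \<open>The logistic law and its complex moment generating function\<close>

text \<open>
  The condition on the values \<open>E exp (a L)\<close> characterises the standard logistic law; it is the form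
  in which the law is produced by the Beta and Gamma integrals and in which it is continued
  analytically.
\<close>

definition has_logistic_mgf :: "'a measure \<Rightarrow> ('a \<Rightarrow> real) \<Rightarrow> bool" where
  "has_logistic_mgf M L \<longleftrightarrow> L \<in> borel_measurable M \<and>
     (\<forall>a. \<bar>a\<bar> < 1 \<longrightarrow>
        has_bochner_integral M (\<lambda>\<omega>. exp (a * L \<omega>)) (Gamma (1 + a) * Gamma (1 - a)))"

lemma has_logistic_mgf_measurable: "has_logistic_mgf M L \<Longrightarrow> L \<in> borel_measurable M"
  by (simp add: has_logistic_mgf_def)

lemma has_logistic_mgf_integrable_exp_abs:
  assumes L: "has_logistic_mgf M L" and r: "0 \<le> r" "r < 1"
  shows "integrable M (\<lambda>\<omega>. exp (r * \<bar>L \<omega>\<bar>))"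
proof (rule Bochner_Integration.integrable_bound)
  note [measurable] = has_logistic_mgf_measurable[OF L]
  have "integrable M (\<lambda>\<omega>. exp (a * L \<omega>))" if "\<bar>a\<bar> < 1" for a
    using L that by (auto simp: has_logistic_mgf_def has_bochner_integral_iff)
  from this[of r] this[of "- r"]
  show "integrable M (\<lambda>\<omega>. exp (r * L \<omega>) + exp (- r * L \<omega>))"
    using r by (intro Bochner_Integration.integrable_add) auto
  show "AE \<omega> in M. norm (exp (r * \<bar>L \<omega>\<bar>)) \<le> norm (exp (r * L \<omega>) + exp (- r * L \<omega>))"
  proof (intro AE_I2)
    fix \<omega>
    have "exp (r * \<bar>L \<omega>\<bar>) \<le> exp (r * L \<omega>) + exp (- r * L \<omega>)"
      by (cases "L \<omega> \<ge> 0") auto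
    thus "norm (exp (r * \<bar>L \<omega>\<bar>)) \<le> norm (exp (r * L \<omega>) + exp (- r * L \<omega>))"
      by simp
  qed
  show "(\<lambda>\<omega>. exp (r * \<bar>L \<omega>\<bar>)) \<in> borel_measurable M"
    by measurable
qed

text \<open>
  Both sides are holomorphic on the unit disc and agree on its real diameter, hence everywhere.
\<close>

lemma logistic_mgf_complex:
  assumes L: "has_logistic_mgf M L" and z: "norm z < 1"
  shows "(\<integral>\<omega>. exp (z * complex_of_real (L \<omega>)) \<partial>M) = Gamma (1 + z) * Gamma (1 - z)"
proof -
  note [measurable] = has_logistic_mgf_measurable[OF L]
  let ?F = "\<lambda>z. \<integral>\<omega>. exp (z * complex_of_real (L \<omega>)) \<partial>M"
  let ?G = "\<lambda>z::complex. Gamma (1 + z) * Gamma (1 - z)"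
  have F_holo: "?F holomorphic_on ball 0 1"
  proof (rule power_series_holomorphic)
    fix w :: complex assume "w \<in> ball 0 1"
    \<comment> \<open>The midpoint between \<open>norm w\<close> and 1 serves as a positive exponent even for \<open>w = 0\<close>.\<close>
    define r where "r = (norm w + 1) / 2"
    have r: "r > 0" "norm w \<le> r" "r < 1"
      using \<open>w \<in> ball 0 1\<close> by (auto simp: r_def intro: add_nonneg_pos)
    have "(\<lambda>k. (\<integral>\<omega>. complex_of_real (L \<omega>) ^ k \<partial>M) * w ^ k / fact k) sums ?F w"
      by (rule integral_exp_power_series[OF _ r(1,2)])
         (use has_logistic_mgf_integrable_exp_abs[OF L, of r] r in auto)
    thus "(\<lambda>k. (\<integral>\<omega>. complex_of_real (L \<omega>) ^ k \<partial>M) / fact k * (w - 0) ^ k) sums ?F w"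
      by (simp add: field_simps)
  qed
  have G_holo: "?G holomorphic_on ball 0 1"
  proof (intro holomorphic_intros)
    fix w :: complex assume "w \<in> ball 0 1"
    hence "\<bar>Re w\<bar> < 1"
      using abs_Re_le_cmod[of w] by simp
    thus "1 + w \<notin> \<int>\<^sub>\<le>\<^sub>0" "1 - w \<notin> \<int>\<^sub>\<le>\<^sub>0"
      by (auto elim!: nonpos_Ints_cases simp: complex_eq_iff)
  qed
  have "?F z - ?G z = 0"
  proof (rule analytic_continuation[of "\<lambda>z. ?F z - ?G z" "ball 0 1" "complex_of_real ` {-1<..<1}" 0])
    show "(\<lambda>z. ?F z - ?G z) holomorphic_on ball 0 1"
      by (intro holomorphic_on_diff F_holo G_holo)
    show "0 islimpt complex_of_real ` {-1<..<1}"
    proof (subst islimpt_sequential, intro exI conjI allI)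
      let ?u = "\<lambda>n. complex_of_real (1 / real (n + 2))"
      show "?u n \<in> complex_of_real ` {-1<..<1} - {0}" for n
      proof (intro DiffI imageI)
        show "1 / real (n + 2) \<in> {-1<..<1}"
          by (simp add: field_simps)
        have "1 / real (n + 2) \<noteq> 0"
          by simp
        thus "?u n \<notin> {0}"
          by (simp only: singleton_iff of_real_eq_0_iff not_False_eq_True)
      qed
      have "(\<lambda>n. 1 / real (n + 2)) \<longlonglongrightarrow> 0"
        using LIMSEQ_ignore_initial_segment[OF lim_1_over_n, of 2] by simp
      hence "?u \<longlonglongrightarrow> complex_of_real 0"
        by (rule tendsto_of_real)
      thus "?u \<longlonglongrightarrow> 0"
        by (simp only: of_real_0)
    qed
    fix w assume "w \<in> complex_of_real ` {-1<..<1}"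
    then obtain a where a: "w = complex_of_real a" "\<bar>a\<bar> < 1"
      by auto
    have "?F w = (\<integral>\<omega>. complex_of_real (exp (a * L \<omega>)) \<partial>M)"
      unfolding a by (simp flip: exp_of_real)
    also have "\<dots> = complex_of_real (Gamma (1 + a) * Gamma (1 - a))"
      using L a by (simp add: has_logistic_mgf_def has_bochner_integral_iff)
    also have "\<dots> = ?G w"
      unfolding a by (simp flip: Gamma_complex_of_real)
    finally show "?F w - ?G w = 0"
      by simp
  qed (use z in auto)
  thus ?thesis
    by simp
qed

section \<open>Bernoulli polynomials as moments\<close>

text \<open>
  With \<open>z = \<i> t / (2 \<pi>)\<close> the reflection formula gives
  \<open>\<Gamma>(1 + z) \<Gamma>(1 - z) = \<pi> z / sin (\<pi> z) = t / (exp (t / 2) - exp (- t / 2))\<close>, and the factor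
  \<open>exp (t (x - 1 / 2))\<close> absorbs the symmetrising \<open>exp (- t / 2)\<close>.
\<close>

lemma bernoulli_gf_Gamma:
  fixes t x :: real
  defines "z \<equiv> \<i> * complex_of_real t / (2 * complex_of_real pi)"
  shows "exp (complex_of_real (t * (x - 1 / 2))) * (Gamma (1 + z) * Gamma (1 - z)) =
           complex_of_real (bernoulli_gf x t)"
proof (cases "t = 0")
  case False
  define q where "q = exp (complex_of_real (t / 2))"
  have q: "q \<noteq> 0" "q * q = complex_of_real (exp t)"
    by (auto simp: q_def simp flip: exp_add exp_of_real)
  have "exp t \<noteq> 1"
    using False by simp
  hence q2: "q * q - 1 \<noteq> 0"
    unfolding q by (metis eq_iff_diff_eq_0 of_real_1 of_real_eq_iff)
  have piz: "complex_of_real pi * z = \<i> * complex_of_real (t / 2)"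
    by (simp add: z_def)
  have sin: "sin (complex_of_real pi * z) = \<i> * (q - 1 / q) / 2"
    unfolding piz sin_exp_eq by (simp add: q_def exp_minus field_simps)
  have "z = \<i> * complex_of_real (t / (2 * pi))"
    by (simp add: z_def)
  hence "Im z \<noteq> 0"
    using False by (simp only: Im_i_times Re_complex_of_real) simp
  hence "z \<notin> \<int>\<^sub>\<le>\<^sub>0"
    by (auto elim!: nonpos_Ints_cases)
  hence "Gamma (1 + z) * Gamma (1 - z) = z * (Gamma z * Gamma (1 - z))"
    using Gamma_plus1[of z] by (simp add: add.commute)
  also have "\<dots> = (complex_of_real pi * z) / sin (complex_of_real pi * z)"
    by (simp add: Gamma_reflection_complex)
  also have "\<dots> = complex_of_real t * q / (q * q - 1)"
    unfolding sin unfolding piz using q(1) q2 by (simp add: field_simps)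
  finally have G: "Gamma (1 + z) * Gamma (1 - z) = complex_of_real t * q / (q * q - 1)" .
  have shift: "exp (complex_of_real (t * (x - 1 / 2))) * q = complex_of_real (exp (t * x))"
    unfolding q_def exp_of_real of_real_mult[symmetric] exp_add[symmetric] by (simp add: algebra_simps)
  have "exp (complex_of_real (t * (x - 1 / 2))) * (complex_of_real t * q / (q * q - 1)) =
          complex_of_real t * (exp (complex_of_real (t * (x - 1 / 2))) * q) / (q * q - 1)"
    by (simp only: times_divide_eq_right times_divide_eq_left mult_ac)
  also have "\<dots> = complex_of_real t * complex_of_real (exp (t * x)) / (complex_of_real (exp t) - 1)"
    by (simp only: shift q(2))
  also have "\<dots> = complex_of_real (bernoulli_gf x t)"
    using False by (simp add: bernoulli_gf_def)
  finally show ?thesis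
    unfolding G .
qed (simp add: z_def bernoulli_gf_def)

lemma bernoulli_poly_eq_logistic_moment:
  fixes L :: "'a \<Rightarrow> real" and x :: real
  assumes L: "has_logistic_mgf M L"
  defines "W \<equiv> \<lambda>\<omega>. \<i> / (2 * complex_of_real pi) * complex_of_real (L \<omega>) + complex_of_real x - 1 / 2"
  shows "integrable M (\<lambda>\<omega>. W \<omega> ^ n)"
    and "complex_of_real (bernoulli_poly n x) = (\<integral>\<omega>. W \<omega> ^ n \<partial>M)"
proof -
  note [measurable] = has_logistic_mgf_measurable[OF L]
  have W_meas [measurable]: "W \<in> borel_measurable M"
    unfolding W_def by measurable
  have exp_int: "integrable M (\<lambda>\<omega>. exp (r * norm (W \<omega>)))" if r: "0 < r" "r < 2 * pi" for r
  proof (rule Bochner_Integration.integrable_bound)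
    show "integrable M (\<lambda>\<omega>. exp (r * \<bar>x - 1 / 2\<bar>) * exp (r / (2 * pi) * \<bar>L \<omega>\<bar>))"
      using r by (intro integrable_mult_right has_logistic_mgf_integrable_exp_abs[OF L]) auto
    have "norm (W \<omega>) \<le> \<bar>L \<omega>\<bar> / (2 * pi) + \<bar>x - 1 / 2\<bar>" for \<omega>
    proof -
      have "W \<omega> = \<i> / (2 * complex_of_real pi) * complex_of_real (L \<omega>) + complex_of_real (x - 1 / 2)"
        by (simp add: W_def)
      also have "norm \<dots> \<le> norm (\<i> / (2 * complex_of_real pi) * complex_of_real (L \<omega>)) +
                            norm (complex_of_real (x - 1 / 2))"
        by (rule norm_triangle_ineq)
      finally show ?thesis
        by (simp only: norm_of_real) (simp add: norm_mult norm_divide)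
    qed
    hence "r * norm (W \<omega>) \<le> r * \<bar>x - 1 / 2\<bar> + r / (2 * pi) * \<bar>L \<omega>\<bar>" for \<omega>
      using mult_left_mono[of "norm (W \<omega>)" "\<bar>L \<omega>\<bar> / (2 * pi) + \<bar>x - 1 / 2\<bar>" r] r
      by (simp add: algebra_simps)
    thus "AE \<omega> in M. norm (exp (r * norm (W \<omega>))) \<le>
            norm (exp (r * \<bar>x - 1 / 2\<bar>) * exp (r / (2 * pi) * \<bar>L \<omega>\<bar>))"
      by (intro AE_I2) (simp flip: exp_add)
  qed measurable
  show "integrable M (\<lambda>\<omega>. W \<omega> ^ n)"
    by (rule integrable_power_of_exp_norm[OF W_meas, of 1])
       (use exp_int[of 1] pi_gt3 in auto)
  have exp_W: "(\<integral>\<omega>. exp (complex_of_real t * W \<omega>) \<partial>M) = complex_of_real (bernoulli_gf x t)"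
    if t: "\<bar>t\<bar> < 2 * pi" for t
  proof -
    let ?z = "\<i> * complex_of_real t / (2 * complex_of_real pi)"
    have "exp (complex_of_real t * W \<omega>) =
            exp (complex_of_real (t * (x - 1 / 2))) * exp (?z * complex_of_real (L \<omega>))" for \<omega>
      unfolding W_def exp_add[symmetric] by (rule arg_cong[of _ _ exp]) (simp add: algebra_simps)
    hence "(\<integral>\<omega>. exp (complex_of_real t * W \<omega>) \<partial>M) =
             exp (complex_of_real (t * (x - 1 / 2))) * (\<integral>\<omega>. exp (?z * complex_of_real (L \<omega>)) \<partial>M)"
      by simp
    also have "(\<integral>\<omega>. exp (?z * complex_of_real (L \<omega>)) \<partial>M) = Gamma (1 + ?z) * Gamma (1 - ?z)"
      by (rule logistic_mgf_complex[OF L]) (use t in \<open>simp add: norm_mult norm_divide\<close>)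
    finally show ?thesis
      by (simp only: bernoulli_gf_Gamma)
  qed
  define m where "m k = (\<integral>\<omega>. W \<omega> ^ k \<partial>M)" for k
  have m_sums: "(\<lambda>k. m k * complex_of_real (t ^ k / fact k)) sums complex_of_real (bernoulli_gf x t)"
    if t: "\<bar>t\<bar> < 2 * pi" for t
  proof -
    define r where "r = (\<bar>t\<bar> + 2 * pi) / 2"
    have r: "0 < r" "norm (complex_of_real t) \<le> r" "r < 2 * pi"
      using t by (auto simp: r_def)
    have "(\<lambda>k. m k * complex_of_real t ^ k / fact k) sums (\<integral>\<omega>. exp (complex_of_real t * W \<omega>) \<partial>M)"
      unfolding m_def by (rule integral_exp_power_series[OF W_meas r(1,2) exp_int[OF r(1,3)]])
    thus ?thesis
      by (simp add: exp_W[OF t])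
  qed
  have re: "(\<lambda>k. Re (m k) * t ^ k / fact k) sums bernoulli_gf x t" if "\<bar>t\<bar> < 2 * pi" for t
    using sums_Re[OF m_sums[OF that]]
    by (simp only: times_complex.sel Re_complex_of_real Im_complex_of_real mult_zero_right
          diff_zero times_divide_eq_right)
  have im: "(\<lambda>k. Im (m k) * t ^ k / fact k) sums 0" if "\<bar>t\<bar> < 2 * pi" for t
    using sums_Im[OF m_sums[OF that]]
    by (simp only: times_complex.sel Re_complex_of_real Im_complex_of_real mult_zero_right
          add_0 times_divide_eq_right)
  have Re_m: "(\<lambda>k. bernoulli_poly k x) = (\<lambda>k. Re (m k))"
    by (rule bernoulli_gf_expansion_unique[OF bernoulli_poly_sums re])
  \<comment> \<open>Perturbing the coefficients by the imaginary parts does not change the sum, so uniqueness of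
    the expansion also forces the imaginary parts to vanish.\<close>
  have "(\<lambda>k. Re (m k) + Im (m k)) = (\<lambda>k. Re (m k))"
  proof (rule bernoulli_gf_expansion_unique[OF _ re])
    show "(\<lambda>k. (Re (m k) + Im (m k)) * t ^ k / fact k) sums bernoulli_gf x t"
      if "\<bar>t\<bar> < 2 * pi" for t
      using sums_add[OF re[OF that] im[OF that]] by (simp add: algebra_simps add_divide_distrib)
  qed
  hence "Im (m n) = 0"
    by (auto dest: fun_cong[of _ _ n])
  thus "complex_of_real (bernoulli_poly n x) = (\<integral>\<omega>. W \<omega> ^ n \<partial>M)"
    using fun_cong[OF Re_m, of n] by (simp add: m_def complex_eq_iff)
qed

section \<open>Two logistic random variables\<close>

lemma distributed_has_bochner_integral:
  fixes g :: "'b \<Rightarrow> real"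
  assumes "distributed M N X (\<lambda>x. ennreal (f x))" "g \<in> borel_measurable N"
    and "\<And>x. x \<in> space N \<Longrightarrow> 0 \<le> f x" "has_bochner_integral N (\<lambda>x. f x * g x) c"
  shows "has_bochner_integral M (\<lambda>\<omega>. g (X \<omega>)) c"
  using assms(4) distributed_integrable[OF assms(1-3)] distributed_integral[OF assms(1-3)]
  by (simp add: has_bochner_integral_iff)

text \<open>
  Since \<open>exp (a ln (u / (1 - u))) = u powr a * (1 - u) powr (- a)\<close> on the open unit interval, this
  is the Beta integral with parameters \<open>1 + a\<close> and \<open>1 - a\<close>, whose denominator is \<open>\<Gamma>(2) = 1\<close>.
\<close>

lemma (in prob_space) uniform_logit_mgf:
  assumes D: "distributed M lborel U (\<lambda>u. indicator {0..1} u / measure lborel {0..1::real})"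
  shows "has_logistic_mgf M (\<lambda>\<omega>. ln (U \<omega> / (1 - U \<omega>)))"
  unfolding has_logistic_mgf_def
proof (intro conjI allI impI)
  have [measurable]: "U \<in> borel_measurable M"
    using distributed_measurable[OF D] by simp
  show "(\<lambda>\<omega>. ln (U \<omega> / (1 - U \<omega>))) \<in> borel_measurable M"
    by measurable
  fix a :: real assume a: "\<bar>a\<bar> < 1"
  have pos: "1 + a > 0" "1 - a > 0"
    using a by auto
  let ?h = "\<lambda>u. u powr (1 + a - 1) * (1 - u) powr (1 - a - 1) :: real"
  have h_int: "set_integrable lborel {0..1} ?h"
    by (rule integrable_Beta[OF pos])
  have "integral {0..1} ?h = Beta (1 + a) (1 - a)"
    using has_integral_Beta_real[OF pos] by (rule integral_unique)
  also have "\<dots> = Gamma (1 + a) * Gamma (1 - a)"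
    by (simp add: Beta_def Gamma_numeral)
  finally have h: "has_bochner_integral lborel (\<lambda>u. indicator {0..1} u *\<^sub>R ?h u)
                     (Gamma (1 + a) * Gamma (1 - a))"
    using h_int set_borel_integral_eq_integral(2)[OF h_int]
    by (simp add: has_bochner_integral_iff set_integrable_def set_lebesgue_integral_def)
  have "has_bochner_integral lborel
          (\<lambda>u. indicator {0..1} u / measure lborel {0..1::real} * exp (a * ln (u / (1 - u))))
          (Gamma (1 + a) * Gamma (1 - a))"
  proof (rule has_bochner_integralI_AE[OF h])
    \<comment> \<open>At the two endpoints \<open>u / (1 - u)\<close> is not positive, so the logarithm there is a default
      value.\<close>
    have "AE u in lborel. u \<noteq> (0::real)" "AE u in lborel. u \<noteq> (1::real)"
      by (rule AE_lborel_singleton)+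
    thus "AE u in lborel. indicator {0..1} u *\<^sub>R ?h u =
            indicator {0..1} u / measure lborel {0..1::real} * exp (a * ln (u / (1 - u)))"
    proof eventually_elim
      case (elim u)
      show ?case
      proof (cases "u \<in> {0..1}")
        case True
        with elim have "0 < u" "u < 1"
          by auto
        thus ?thesis
          by (simp add: powr_def ln_div algebra_simps flip: exp_add)
      qed simp
    qed
  qed measurable
  thus "has_bochner_integral M (\<lambda>\<omega>. exp (a * ln (U \<omega> / (1 - U \<omega>))))
          (Gamma (1 + a) * Gamma (1 - a))"
    by (intro distributed_has_bochner_integral[OF D]) auto
qed

lemma (in prob_space) exponential_powr_moment:
  assumes D: "distributed M lborel X (exponential_density 1)" and a: "a > -1"
  shows "has_bochner_integral M (\<lambda>\<omega>. X \<omega> powr a) (Gamma (1 + a))"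
proof (rule distributed_has_bochner_integral[OF D])
  have "exponential_density 1 x * x powr a = indicator {0..} x * x powr (1 + a - 1) / exp x" for x
    by (simp add: exponential_density_def exp_minus field_simps)
  moreover have "has_bochner_integral lborel
      (\<lambda>x. indicator {0..} x * x powr (1 + a - 1) / exp x) (Gamma (1 + a))"
    using a by (intro has_bochner_integral_nn_integral Gamma_conv_nn_integral_real[symmetric])
               (auto intro!: Gamma_real_nonneg)
  ultimately show "has_bochner_integral lborel (\<lambda>x. exponential_density 1 x * x powr a) (Gamma (1 + a))"
    by simp
qed (auto simp: exponential_density_nonneg)

lemma (in prob_space) exponential_distributed_AE_pos:
  assumes D: "distributed M lborel X (exponential_density 1)"
  shows "AE \<omega> in M. 0 < X \<omega>"
proof (subst distributed_AE2[OF D])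
  have "AE x in lborel. x \<noteq> (0::real)"
    by (rule AE_lborel_singleton)
  thus "AE x in lborel. 0 < ennreal (exponential_density 1 x) \<longrightarrow> 0 < x"
    by eventually_elim (auto simp: exponential_density_def)
qed measurable

text \<open>
  Almost surely \<open>exp (a ln (X / Y)) = X powr a * Y powr (- a)\<close>, and by independence the expectation
  is the product of two Gamma integrals.
\<close>

lemma (in prob_space) exponential_ratio_mgf:
  assumes D1: "distributed M lborel X (exponential_density 1)"
    and D2: "distributed M lborel Y (exponential_density 1)"
    and indep: "indep_var borel X borel Y"
  shows "has_logistic_mgf M (\<lambda>\<omega>. ln (X \<omega> / Y \<omega>))"
  unfolding has_logistic_mgf_def
proof (intro conjI allI impI)
  have [measurable]: "X \<in> borel_measurable M" "Y \<in> borel_measurable M"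
    using distributed_measurable[OF D1] distributed_measurable[OF D2] by simp_all
  show "(\<lambda>\<omega>. ln (X \<omega> / Y \<omega>)) \<in> borel_measurable M"
    by measurable
  fix a :: real assume a: "\<bar>a\<bar> < 1"
  have X: "has_bochner_integral M (\<lambda>\<omega>. X \<omega> powr a) (Gamma (1 + a))"
    by (rule exponential_powr_moment[OF D1]) (use a in auto)
  have Y: "has_bochner_integral M (\<lambda>\<omega>. Y \<omega> powr (- a)) (Gamma (1 - a))"
    using exponential_powr_moment[OF D2, of "- a"] a by auto
  have "indep_var borel (\<lambda>\<omega>. X \<omega> powr a) borel (\<lambda>\<omega>. Y \<omega> powr (- a))"
    using indep_var_compose[OF indep, of "\<lambda>x. x powr a" borel "\<lambda>y. y powr (- a)" borel]
    by (simp add: comp_def)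
  hence "has_bochner_integral M (\<lambda>\<omega>. X \<omega> powr a * Y \<omega> powr (- a)) (Gamma (1 + a) * Gamma (1 - a))"
    using X Y by (simp add: has_bochner_integral_iff indep_var_integrable indep_var_lebesgue_integral)
  thus "has_bochner_integral M (\<lambda>\<omega>. exp (a * ln (X \<omega> / Y \<omega>))) (Gamma (1 + a) * Gamma (1 - a))"
  proof (rule has_bochner_integralI_AE)
    show "AE \<omega> in M. X \<omega> powr a * Y \<omega> powr (- a) = exp (a * ln (X \<omega> / Y \<omega>))"
      using exponential_distributed_AE_pos[OF D1] exponential_distributed_AE_pos[OF D2]
    proof eventually_elim
      case (elim \<omega>)
      thus ?case
        by (simp add: powr_def ln_div algebra_simps flip: exp_add)
    qed
  qed measurable
qed

theorem corollary1:
  fixes M :: "'a measure" and U E1 E2 :: "'a \<Rightarrow> real"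
  assumes M: "prob_space M"
    and U: "distributed M lborel U (\<lambda>u. indicator {0..1} u / measure lborel {0..1::real})"
    and E1: "distributed M lborel E1 (exponential_density 1)"
    and E2: "distributed M lborel E2 (exponential_density 1)"
    and indep: "prob_space.indep_var M borel E1 borel E2"
  shows
    "(\<forall>(n::nat) (x::real).
        integrable M (\<lambda>\<omega>. (\<i> / (2 * complex_of_real pi) * complex_of_real (ln (U \<omega> / (1 - U \<omega>))) + complex_of_real x - 1 / 2) ^ n) \<and>
        integrable M (\<lambda>\<omega>. (\<i> / (2 * complex_of_real pi) * complex_of_real (ln (E1 \<omega> / E2 \<omega>)) + complex_of_real x - 1 / 2) ^ n) \<and>
        complex_of_real (bernoulli_poly n x) =
          (\<integral>\<omega>. (\<i> / (2 * complex_of_real pi) * complex_of_real (ln (U \<omega> / (1 - U \<omega>))) + complex_of_real x - 1 / 2) ^ n \<partial>M) \<and>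
        complex_of_real (bernoulli_poly n x) =
          (\<integral>\<omega>. (\<i> / (2 * complex_of_real pi) * complex_of_real (ln (E1 \<omega> / E2 \<omega>)) + complex_of_real x - 1 / 2) ^ n \<partial>M)) \<and>
     (\<forall>n::nat.
        integrable M (\<lambda>\<omega>. (\<i> / (2 * complex_of_real pi) * complex_of_real (ln (U \<omega> / (1 - U \<omega>))) - 1 / 2) ^ n) \<and>
        integrable M (\<lambda>\<omega>. (\<i> / (2 * complex_of_real pi) * complex_of_real (ln (E1 \<omega> / E2 \<omega>)) - 1 / 2) ^ n) \<and>
        complex_of_real (bernoulli_num n) =
          (\<integral>\<omega>. (\<i> / (2 * complex_of_real pi) * complex_of_real (ln (U \<omega> / (1 - U \<omega>))) - 1 / 2) ^ n \<partial>M) \<and>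
        complex_of_real (bernoulli_num n) =
          (\<integral>\<omega>. (\<i> / (2 * complex_of_real pi) * complex_of_real (ln (E1 \<omega> / E2 \<omega>)) - 1 / 2) ^ n \<partial>M))"
proof -
  interpret prob_space M by (rule M)
  note logit = bernoulli_poly_eq_logistic_moment[OF uniform_logit_mgf[OF U]]
  note ratio = bernoulli_poly_eq_logistic_moment[OF exponential_ratio_mgf[OF E1 E2 indep]]
  show ?thesis
    using logit ratio logit[where x = 0] ratio[where x = 0] by (auto simp: bernoulli_num_def)
qed

end
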